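(* There is an absolute constant $c>0$ such that the following holds. Let $\Phi$ be an $L^2(D)$-normalized eigenfunction of $\mathcal K_{\mathrm{diag}}^{(0)}$ associated with a simple isolated eigenvalue $\rho$, and let $\Phi_\kappa=\Phi+\delta\phi$ be a corresponding coupled eigenmode of $\mathcal K_D^{(0)}$, with eigenvalue $\rho_\kappa=\rho+\delta\rho$ (in the sense defined in the context). Let $x_1\in\partial D_1$ and $x_2\in\partial D_2$ be closest boundary points, so that $|x_2-x_1|=\kappa$. Assume that: (i) $\varepsilon_2\le c\,d_\rho$; (ii) for some constant $C>0$, $$\|\delta\phi\|_{C^0(\overline D)}\le C\left(\frac{C_0}{|\rho|}\frac{\varepsilon_2}{d_\rho}+\frac{\varepsilon_\infty}{|\rho|}+\frac{\varepsilon_\infty}{|\rho|}\frac{\varepsilon_2}{d_\rho}+\frac{C_0}{|\rho|^2}\frac{\varepsilon_2^2}{d_\rho}\right);$$ (iii) there is $c_*>0$ with $|\Phi(x_2)-\Phi(x_1)|\ge c_*$; (iv) $\|\Phi_\kappa-\Phi\|_{C^0(\overline D)}\le \dfrac{c_*}{4}$. Then there exists a point $y$ on the segment joining $x_1$ and $x_2$ such that $$|\nabla\Phi_\kappa(y)|\ge\frac{c_*}{2\kappa}.$$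
   Context: Setting. $D_1,D_2\subset\mathbb R^3$ are bounded domains whose distance is $\kappa=\operatorname{dist}(D_1,D_2)>0$, and $D=D_1\cup D_2$. The static Newtonian operator on $L^2(D)$ is $$\mathcal K_D^{(0)}[u](x)=-\frac1{4\pi}\int_D\frac{u(y)}{|x-y|}\,dy .$$ With respect to $L^2(D)=L^2(D_1)\oplus L^2(D_2)$, let $\mathcal K_{ij}^{(0)}:L^2(D_j)\to L^2(D_i)$ be $\mathcal K_{ij}^{(0)}[u](x)=-\frac1{4\pi}\int_{D_j}\frac{u(y)}{|x-y|}\,dy$ for $x\in D_i$, and write $\mathcal K_D^{(0)}=\mathcal K_{\mathrm{diag}}^{(0)}+\mathcal K_{\mathrm{off}}^{(0)}$ with $$\mathcal K_{\mathrm{diag}}^{(0)}=\begin{pmatrix}\mathcal K_{11}^{(0)}&0\\0&\mathcal K_{22}^{(0)}\end{pmatrix},\qquad \mathcal K_{\mathrm{off}}^{(0)}=\begin{pmatrix}0&\mathcal K_{12}^{(0)}\\\mathcal K_{21}^{(0)}&0\end{pmatrix}.$$ These operators map $L^2(D)$ continuously into $C^0(\overline D)$; in particular eigenfunctions are identified with their continuous representatives on $\overline D$. Quantities. $d_\rho=\operatorname{dist}(\rho,\operatorname{sp}(\mathcal K_{\mathrm{diag}}^{(0)})\setminus\{\rho\})>0$, $\varepsilon_2=\|\mathcal K_{\mathrm{off}}^{(0)}\|_{L^2\to L^2}$, $\varepsilon_\infty=\|\mathcal K_{\mathrm{off}}^{(0)}\|_{L^2\to C^0}$, $C_0=\|\mathcal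 K_{\mathrm{diag}}^{(0)}\|_{L^2\to C^0}$, where $L^2=L^2(D)$ and $C^0=C^0(\overline D)$. Corresponding coupled eigenmode. An eigenpair $(\rho_\kappa,\Phi_\kappa)$ of $\mathcal K_D^{(0)}$ with $\|\Phi_\kappa\|_{L^2(D)}=1$ and $\langle\Phi_\kappa,\Phi\rangle_{L^2(D)}\in\mathbb R_{>0}$ such that, with $\delta\phi=\Phi_\kappa-\Phi$ and $\delta\rho=\rho_\kappa-\rho$, for some constant $C_1>0$: $$\|\delta\phi\|_{L^2}\le C_1\frac{\varepsilon_2}{d_\rho},\qquad \|\delta\phi+S_\rho\mathcal K_{\mathrm{off}}^{(0)}\Phi\|_{L^2}\le C_1\frac{\varepsilon_2^2}{d_\rho^2},\qquad |\delta\rho-\langle\mathcal K_{\mathrm{off}}^{(0)}\Phi,\Phi\rangle_{L^2}|\le C_1\frac{\varepsilon_2^2}{d_\rho},$$ where $S_\rho=Q_\rho(\mathcal K_{\mathrm{diag}}^{(0)}-\rho I)^{-1}Q_\rho$ is the reduced resolvent, $Q_\rho=I-P_\rho$, and $P_\rho$ is the orthogonal projection onto $\operatorname{span}\{\Phi\}$. The mode $\Phi_\kappa$ is extended to all of $\mathbb R^3$ (in particular to the gap between $D_1$ and $D_2$) through the integral representation $\Phi_\kappa(x)=\rho_\kappa^{-1}\,\mathcal K_D^{(0)}[\Phi_\kappa](x)=-\frac{1}{4\pi\rho_\kappa}\int_D\frac{\Phi_\kappa(y)}{|x-y|}\,dy$, $x\in\mathbb R^3$. *)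

theory Defs
  imports "HOL-Analysis.Analysis"
begin

section \<open>The complex space \<open>L\<^sup>2(D)\<close>, by representatives\<close>

text \<open>
  Elements of \<open>L\<^sup>2(D)\<close> are represented by functions on all of \<open>\<real>\<^sup>3\<close>, of which only the values on
  \<open>D\<close> up to null sets matter. Equality in \<open>L\<^sup>2(D)\<close> is equality almost everywhere on \<open>D\<close>.
\<close>

type_synonym field3 = "real^3 \<Rightarrow> complex"

definition L2 :: "(real^3) set \<Rightarrow> field3 set" where
  "L2 D = {u. u \<in> borel_measurable (lebesgue_on D) \<and> integrable (lebesgue_on D) (\<lambda>x. (norm (u x))\<^sup>2)}"

definition l2eq :: "(real^3) set \<Rightarrow> field3 \<Rightarrow> field3 \<Rightarrow> bool" where
  "l2eq D u v \<longleftrightarrow> (AE x in lebesgue_on D. u x = v x)"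

definition l2inner :: "(real^3) set \<Rightarrow> field3 \<Rightarrow> field3 \<Rightarrow> complex" where
  "l2inner D u v = (LINT x|lebesgue_on D. u x * cnj (v x))"

definition l2norm :: "(real^3) set \<Rightarrow> field3 \<Rightarrow> real" where
  "l2norm D u = sqrt (LINT x|lebesgue_on D. (norm (u x))\<^sup>2)"

definition c0norm :: "(real^3) set \<Rightarrow> field3 \<Rightarrow> real"
  \<comment> \<open>the norm of \<open>C\<^sup>0\<close> on the closure of \<open>D\<close>\<close>
  where "c0norm D u = (SUP x\<in>closure D. norm (u x))"

section \<open>Operators on \<open>L\<^sup>2(D)\<close>\<close>

text \<open>
  As for the library's \<^const>\<open>onorm\<close>, the operator norms are suprema of quotients; representatives
  of \<open>0\<close> contribute the value \<open>0\<close> because \<open>x / 0 = 0\<close>.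
\<close>

definition opnorm_L2_L2 :: "(real^3) set \<Rightarrow> (field3 \<Rightarrow> field3) \<Rightarrow> real" where
  "opnorm_L2_L2 D T = (SUP u\<in>L2 D. l2norm D (T u) / l2norm D u)"

definition opnorm_L2_C0 :: "(real^3) set \<Rightarrow> (field3 \<Rightarrow> field3) \<Rightarrow> real" where
  "opnorm_L2_C0 D T = (SUP u\<in>L2 D. c0norm D (T u) / l2norm D u)"

text \<open>
  \<open>z\<close> is in the resolvent set if \<open>T - z I\<close> is a bijection of \<open>L\<^sup>2(D)\<close> with bounded inverse.
\<close>

definition l2_resolvent_set :: "(real^3) set \<Rightarrow> (field3 \<Rightarrow> field3) \<Rightarrow> complex set" where
  "l2_resolvent_set D T = {z.
     (\<forall>u\<in>L2 D. l2eq D (\<lambda>x. T u x - z * u x) (\<lambda>x. 0) \<longrightarrow> l2eq D u (\<lambda>x. 0)) \<and>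
     (\<exists>B. \<forall>f\<in>L2 D. \<exists>u\<in>L2 D.
        l2eq D (\<lambda>x. T u x - z * u x) f \<and> l2norm D u \<le> B * l2norm D f)}"

definition l2_spectrum :: "(real^3) set \<Rightarrow> (field3 \<Rightarrow> field3) \<Rightarrow> complex set" where
  "l2_spectrum D T = - l2_resolvent_set D T"

text \<open>
  An eigenfunction is always given by its representative that is continuous on the closure of \<open>D\<close>.
\<close>

definition eigenpair :: "(real^3) set \<Rightarrow> (field3 \<Rightarrow> field3) \<Rightarrow> complex \<Rightarrow> field3 \<Rightarrow> bool" where
  "eigenpair D T z u \<longleftrightarrow>
     u \<in> L2 D \<and> continuous_on (closure D) u \<and> \<not> l2eq D u (\<lambda>x. 0) \<and>
     l2eq D (T u) (\<lambda>x. z * u x)"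

text \<open>
  Simple means that the eigenspace is one-dimensional; the operators considered here are
  self-adjoint, so that geometric and algebraic multiplicity agree.
\<close>

definition simple_eigenvalue :: "(real^3) set \<Rightarrow> (field3 \<Rightarrow> field3) \<Rightarrow> complex \<Rightarrow> bool" where
  "simple_eigenvalue D T z \<longleftrightarrow>
     (\<exists>u\<in>L2 D. \<not> l2eq D u (\<lambda>x. 0) \<and> l2eq D (T u) (\<lambda>x. z * u x) \<and>
        (\<forall>v\<in>L2 D. l2eq D (T v) (\<lambda>x. z * v x) \<longrightarrow> (\<exists>a. l2eq D v (\<lambda>x. a * u x))))"

text \<open>
  For a unit vector \<open>\<Phi>\<close> spanning the kernel of \<open>T - z I\<close>: the complementary projection
  \<open>Q = I - P\<close> and the reduced resolvent \<open>Q (T - z I)\<^sup>-\<^sup>1 Q\<close>, in which the inverse is that of the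
  restriction of \<open>T - z I\<close> to the range of \<open>Q\<close>. The choice only selects a representative.
\<close>

definition coproj :: "(real^3) set \<Rightarrow> field3 \<Rightarrow> field3 \<Rightarrow> field3" where
  "coproj D \<Phi> u = (\<lambda>x. u x - l2inner D u \<Phi> * \<Phi> x)"

definition reduced_resolvent ::
  "(real^3) set \<Rightarrow> (field3 \<Rightarrow> field3) \<Rightarrow> complex \<Rightarrow> field3 \<Rightarrow> field3 \<Rightarrow> field3" where
  "reduced_resolvent D T z \<Phi> f = coproj D \<Phi>
     (SOME v. v \<in> L2 D \<and> l2eq D (coproj D \<Phi> v) v \<and>
        l2eq D (\<lambda>x. T v x - z * v x) (coproj D \<Phi> f))"

section \<open>Newtonian operators\<close>

definition newton :: "(real^3) set \<Rightarrow> field3 \<Rightarrow> field3" where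
  "newton D u x =
     - (1 / (4 * of_real pi)) * (LINT y|lebesgue_on D. u y / of_real (norm (x - y)))"

text \<open>
  The block parts for \<open>D = D1 \<union> D2\<close> are defined on the (disjoint) closures of \<open>D1\<close> and \<open>D2\<close>,
  so that their images are the continuous representatives on the closure of \<open>D\<close>.
\<close>

definition newton_diag :: "(real^3) set \<Rightarrow> (real^3) set \<Rightarrow> field3 \<Rightarrow> field3" where
  "newton_diag D1 D2 u x =
     (if x \<in> closure D1 then newton D1 u x else if x \<in> closure D2 then newton D2 u x else 0)"

definition newton_off :: "(real^3) set \<Rightarrow> (real^3) set \<Rightarrow> field3 \<Rightarrow> field3" where
  "newton_off D1 D2 u x =
     (if x \<in> closure D1 then newton D2 u x else if x \<in> closure D2 then newton D1 u x else 0)"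

definition eps2 :: "(real^3) set \<Rightarrow> (real^3) set \<Rightarrow> real" where
  "eps2 D1 D2 = opnorm_L2_L2 (D1 \<union> D2) (newton_off D1 D2)"

definition eps_inf :: "(real^3) set \<Rightarrow> (real^3) set \<Rightarrow> real" where
  "eps_inf D1 D2 = opnorm_L2_C0 (D1 \<union> D2) (newton_off D1 D2)"

definition C0_diag :: "(real^3) set \<Rightarrow> (real^3) set \<Rightarrow> real" where
  "C0_diag D1 D2 = opnorm_L2_C0 (D1 \<union> D2) (newton_diag D1 D2)"

definition spec_gap :: "(real^3) set \<Rightarrow> (real^3) set \<Rightarrow> complex \<Rightarrow> real" where
  "spec_gap D1 D2 \<rho> = infdist \<rho> (l2_spectrum (D1 \<union> D2) (newton_diag D1 D2) - {\<rho>})"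

definition coupled_eigenmode ::
  "(real^3) set \<Rightarrow> (real^3) set \<Rightarrow> complex \<Rightarrow> field3 \<Rightarrow> complex \<Rightarrow> field3 \<Rightarrow> bool" where
  "coupled_eigenmode D1 D2 \<rho> \<Phi> \<rho>\<kappa> \<Phi>\<kappa> \<longleftrightarrow>
     (let D = D1 \<union> D2; \<epsilon> = eps2 D1 D2; d = spec_gap D1 D2 \<rho>;
          \<delta>\<phi> = (\<lambda>x. \<Phi>\<kappa> x - \<Phi> x); \<delta>\<rho> = \<rho>\<kappa> - \<rho>;
          Koff = newton_off D1 D2;
          S = reduced_resolvent D (newton_diag D1 D2) \<rho> \<Phi>
      in eigenpair D (newton D) \<rho>\<kappa> \<Phi>\<kappa> \<and> l2norm D \<Phi>\<kappa> = 1 \<and>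
         l2inner D \<Phi>\<kappa> \<Phi> \<in> \<real> \<and> Re (l2inner D \<Phi>\<kappa> \<Phi>) > 0 \<and>
         (\<exists>C1>0.
            l2norm D \<delta>\<phi> \<le> C1 * (\<epsilon> / d) \<and>
            l2norm D (\<lambda>x. \<delta>\<phi> x + S (Koff \<Phi>) x) \<le> C1 * (\<epsilon>\<^sup>2 / d\<^sup>2) \<and>
            norm (\<delta>\<rho> - l2inner D (Koff \<Phi>) \<Phi>) \<le> C1 * (\<epsilon>\<^sup>2 / d)))"

definition cgrad :: "field3 \<Rightarrow> real^3 \<Rightarrow> complex^3" where
  "cgrad f y = (\<chi> j. frechet_derivative f (at y) (axis j 1))"

definition bounded_domain :: "(real^3) set \<Rightarrow> bool" where
  "bounded_domain U \<longleftrightarrow> open U \<and> connected U \<and> U \<noteq> {} \<and> bounded U"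

end

theory Submission
  imports Defs
begin

text \<open>
  The perturbed mode stays within \<open>cs / 4\<close> of \<open>\<Phi>\<close> at both contact points, so the jump of \<open>\<Phi>\<close> across
  the gap, which is at least \<open>cs\<close>, leaves a jump of at least \<open>cs / 2\<close> for \<open>\<Phi>\<kappa>\<close>. The gap has width \<open>\<kappa>\<close>, and the mean
  value inequality along the segment from \<open>x1\<close> to \<open>x2\<close> then produces a point at which the gradient
  is at least \<open>cs / (2 * \<kappa>)\<close>. Being a statement about the size of a vector-valued difference, the mean
  value inequality suits the complex-valued mode: only the norm of the increment is compared.

  What has to be justified is that \<open>\<Phi>\<kappa>\<close> is regular enough along the segment. Since \<open>x1\<close> and \<open>x2\<close>
  realise the distance of the two domains, no interior point of the segment lies in the closure of
  either domain (\<open>shortest_segment_avoids_closures\<close>). There \<open>\<Phi>\<kappa>\<close>, a multiple of the Newtonian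
  potential of its own restriction to the domains, may be differentiated under the integral sign
  (\<open>differentiable_potential\<close>), because the kernel is smooth away from its singularity. At the two end
  points, which lie on the boundary, differentiability is out of reach of this argument, but
  continuity suffices (\<open>continuous_potential\<close>): the density is bounded, being continuous on a compact
  closure, and the kernel \<open>1 / |x - y|\<close> is uniformly integrable over small balls in dimension three.
\<close>

section \<open>Integrability of the Newtonian kernel near its singularity\<close>

lemma dyadic_shell:
  fixes t r :: real
  assumes "0 < t" "t < r"
  obtains k :: nat where "r / 2 ^ Suc k \<le> t" "t < r / 2 ^ k"
proof -
  define k where "k = (LEAST n. r / 2 ^ Suc n \<le> t)"
  obtain n where "(1/2::real) ^ n < t / r"
    using real_arch_pow_inv[of "t/r" "1/2"] assms by auto
  then have "r / 2 ^ n < t"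
    using assms by (simp add: field_simps power_divide)
  moreover have "r / 2 ^ Suc n \<le> r / 2 ^ n"
    using assms by (simp add: field_simps)
  ultimately have "r / 2 ^ Suc n \<le> t"
    by linarith
  then have k: "r / 2 ^ Suc k \<le> t"
    unfolding k_def by (rule LeastI)
  have "t < r / 2 ^ k"
  proof (cases k)
    case 0
    then show ?thesis using assms by simp
  next
    case (Suc m)
    then have "\<not> r / 2 ^ Suc m \<le> t"
      using not_less_Least[of m "\<lambda>n. r / 2 ^ Suc n \<le> t"] k_def by simp
    then show ?thesis using Suc by simp
  qed
  with k show ?thesis using that by blast
qed

text \<open>
  Cut the ball into dyadic shells: on the shell of radius about \<open>r / 2 ^ k\<close> the kernel is of order
  \<open>2 ^ k / r\<close>, while the volume is of order \<open>r ^ 3 / 8 ^ k\<close>, so the contributions decay like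
  \<open>r\<^sup>2 / 4 ^ k\<close> and sum to a multiple of \<open>r\<^sup>2\<close>. That the bound vanishes with \<open>r\<close>, uniformly in the
  centre, is what makes the potential continuous.
\<close>

lemma nn_integral_inverse_distance_ball_le:
  fixes x :: "real^3"
  assumes "0 < r"
  shows "(\<integral>\<^sup>+y. ennreal (indicat_real (ball x r) y / norm (x - y)) \<partial>lebesgue)
           \<le> ennreal (8 / 3 * unit_ball_vol 3 * r\<^sup>2)"
proof -
  define B where "B k = ball x (r / 2 ^ k)" for k :: nat
  \<comment> \<open>Balls may replace shells, since every term is nonnegative. The centre contributes \<open>1 / 0 = 0\<close>.\<close>
  have pw: "ennreal (indicat_real (ball x r) y / norm (x - y))
      \<le> (\<Sum>k. ennreal (2 ^ Suc k / r) * indicator (B k) y)" for y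
  proof (cases "y \<in> ball x r \<and> y \<noteq> x")
    case True
    then have "0 < norm (x - y)" "norm (x - y) < r"
      by (auto simp: dist_norm)
    then obtain k where k: "r / 2 ^ Suc k \<le> norm (x - y)" "norm (x - y) < r / 2 ^ k"
      by (rule dyadic_shell)
    have "1 / norm (x - y) \<le> 1 / (r / 2 ^ Suc k)"
      using assms k \<open>0 < norm (x - y)\<close> by (intro divide_left_mono mult_pos_pos) simp_all
    then have "ennreal (indicat_real (ball x r) y / norm (x - y))
        \<le> ennreal (2 ^ Suc k / r) * indicator (B k) y"
      using k True by (simp add: B_def dist_norm ennreal_leI)
    also have "\<dots> = (\<Sum>j\<in>{k}. ennreal (2 ^ Suc j / r) * indicator (B j) y)"
      by (simp only: sum.insert finite.emptyI empty_iff not_False_eq_True sum.empty add_0_right)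
    also have "\<dots> \<le> (\<Sum>k. ennreal (2 ^ Suc k / r) * indicator (B k) y)"
      by (rule sum_le_suminf) auto
    finally show ?thesis .
  qed auto
  have "(\<integral>\<^sup>+y. ennreal (indicat_real (ball x r) y / norm (x - y)) \<partial>lebesgue)
      \<le> (\<integral>\<^sup>+y. (\<Sum>k. ennreal (2 ^ Suc k / r) * indicator (B k) y) \<partial>lebesgue)"
    by (intro nn_integral_mono pw)
  also have "\<dots> = (\<Sum>k. \<integral>\<^sup>+y. ennreal (2 ^ Suc k / r) * indicator (B k) y \<partial>lebesgue)"
    by (intro nn_integral_suminf borel_measurable_times_ennreal borel_measurable_indicator)
      (auto simp: B_def)
  also have "\<dots> = (\<Sum>k. ennreal (2 * unit_ball_vol 3 * r\<^sup>2 * (1 / 4) ^ k))"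
  proof (intro suminf_cong)
    fix k
    have "(\<integral>\<^sup>+y. ennreal (2 ^ Suc k / r) * indicator (B k) y \<partial>lebesgue)
        = ennreal (2 ^ Suc k / r) * emeasure lborel (B k)"
      by (subst nn_integral_cmult_indicator) (auto simp: B_def)
    also have "\<dots> = ennreal (2 ^ Suc k / r) * ennreal (unit_ball_vol 3 * (r / 2 ^ k) ^ 3)"
      using assms by (simp add: B_def emeasure_ball)
    also have "\<dots> = ennreal (2 ^ Suc k / r * (unit_ball_vol 3 * (r / 2 ^ k) ^ 3))"
      using assms by (intro ennreal_mult[symmetric]) auto
    also have "2 ^ Suc k / r * (unit_ball_vol 3 * (r / 2 ^ k) ^ 3)
        = 2 * unit_ball_vol 3 * r\<^sup>2 * (1 / 4) ^ k"
    proof -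
      have "(2::real) ^ k * 2 ^ k = 4 ^ k"
        by (simp flip: power_mult_distrib)
      then show ?thesis
        using assms by (simp add: field_simps power2_eq_square power3_eq_cube)
    qed
    finally show "(\<integral>\<^sup>+y. ennreal (2 ^ Suc k / r) * indicator (B k) y \<partial>lebesgue)
        = ennreal (2 * unit_ball_vol 3 * r\<^sup>2 * (1 / 4) ^ k)" .
  qed
  also have "\<dots> = ennreal (8 / 3 * unit_ball_vol 3 * r\<^sup>2)"
  proof (rule suminf_ennreal_eq)
    have "(\<lambda>k. (1 / 4 :: real) ^ k) sums (4 / 3)"
      using geometric_sums[of "1/4 :: real"] by simp
    from sums_mult[OF this, of "2 * unit_ball_vol 3 * r\<^sup>2"]
    show "(\<lambda>k. 2 * unit_ball_vol 3 * r\<^sup>2 * (1 / 4) ^ k) sums (8 / 3 * unit_ball_vol 3 * r\<^sup>2)"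
      by (simp add: algebra_simps)
  qed (use assms in auto)
  finally show ?thesis .
qed

lemma nn_integral_inverse_distance_lebesgue_on_le:
  fixes x :: "real^3"
  assumes "0 < r" "D \<in> sets lebesgue"
  shows "(\<integral>\<^sup>+y. ennreal (indicat_real (ball x r) y / norm (x - y)) \<partial>lebesgue_on D)
           \<le> ennreal (8 / 3 * unit_ball_vol 3 * r\<^sup>2)"
proof -
  have "(\<integral>\<^sup>+y. ennreal (indicat_real (ball x r) y / norm (x - y)) \<partial>lebesgue_on D)
      = (\<integral>\<^sup>+y. ennreal (indicat_real (ball x r) y / norm (x - y)) * indicator D y \<partial>lebesgue)"
    using assms by (subst nn_integral_restrict_space) auto
  also have "\<dots> \<le> (\<integral>\<^sup>+y. ennreal (indicat_real (ball x r) y / norm (x - y)) \<partial>lebesgue)"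
    by (intro nn_integral_mono) (auto simp: indicator_def)
  finally show ?thesis
    using nn_integral_inverse_distance_ball_le[OF assms(1)] by (rule order_trans)
qed

lemma integral_inverse_distance_near:
  fixes x :: "real^3"
  assumes "0 < r" "D \<in> sets lebesgue"
  shows "integrable (lebesgue_on D) (\<lambda>y. indicat_real (ball x r) y / norm (x - y))"
    and "(LINT y|lebesgue_on D. indicat_real (ball x r) y / norm (x - y))
           \<le> 8 / 3 * unit_ball_vol 3 * r\<^sup>2"
proof -
  have meas: "(\<lambda>y. indicat_real (ball x r) y / norm (x - y)) \<in> borel_measurable (lebesgue_on D)"
    by (intro measurable_restrict_space1 measurable_completion borel_measurable_divide
        borel_measurable_indicator borel_measurable_norm borel_measurable_diff) auto
  show int: "integrable (lebesgue_on D) (\<lambda>y. indicat_real (ball x r) y / norm (x - y))"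
    using nn_integral_inverse_distance_lebesgue_on_le[OF assms, of x] meas
    by (intro integrableI_nonneg) (auto simp: le_less_trans ennreal_less_top)
  show "(LINT y|lebesgue_on D. indicat_real (ball x r) y / norm (x - y))
           \<le> 8 / 3 * unit_ball_vol 3 * r\<^sup>2"
    using nn_integral_inverse_distance_lebesgue_on_le[OF assms, of x] assms
    by (subst (asm) nn_integral_eq_integral[OF int]) auto
qed

section \<open>First-order expansion of the kernel\<close>

text \<open>
  The rationalised difference \<open>1 / q - 1 / p = (p\<^sup>2 - q\<^sup>2) / (p * q * (p + q))\<close> of the inverse norms
  has the numerator \<open>- 2 * (a \<bullet> h) - (norm h)\<^sup>2\<close>, and replacing \<open>q\<close> by \<open>p\<close> in the denominator gives the
  linear term; the error of this replacement is quadratic in \<open>h\<close> because \<open>p\<close> and \<open>q\<close> differ by at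
  most \<open>norm h\<close>. An explicit remainder, uniform as long as \<open>a\<close> and \<open>a + h\<close> stay away from \<open>0\<close>, allows the
  expansion to be integrated over the source points.
\<close>

lemma inverse_norm_taylor:
  fixes a h :: "'a::real_inner"
  assumes "a \<noteq> 0" "a + h \<noteq> 0"
  shows "\<bar>1 / norm (a + h) - 1 / norm a + (a \<bullet> h) / norm a ^ 3\<bar>
           \<le> 3 * (norm h)\<^sup>2 / ((norm a)\<^sup>2 * norm (a + h))"
proof -
  define p q s t where "p = norm a" and "q = norm (a + h)" and "s = a \<bullet> h" and "t = norm h"
  have pos: "0 < p" "0 < q" "0 \<le> t" using assms by (auto simp: p_def q_def t_def)
  have q2: "q\<^sup>2 = p\<^sup>2 + 2 * s + t\<^sup>2"
    unfolding p_def q_def s_def t_def power2_norm_eq_inner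
    by (simp add: inner_add_left inner_add_right inner_commute)
  have s: "\<bar>s\<bar> \<le> p * t"
    unfolding s_def p_def t_def by (rule Cauchy_Schwarz_ineq2)
  have qp: "\<bar>q - p\<bar> \<le> t"
    using norm_triangle_ineq3[of "a + h" a] by (simp add: q_def p_def t_def)
  have "1 / q - 1 / p + s / p ^ 3
      = s * ((q - p) * (q + 2 * p)) / (p ^ 3 * q * (p + q)) - t\<^sup>2 / (p * q * (p + q))"
  proof -
    have "1 / q - 1 / p = (p\<^sup>2 - q\<^sup>2) / (p * q * (p + q))"
      using pos by (simp add: divide_simps) (simp add: algebra_simps power2_eq_square)
    also have "\<dots> = - (2 * s) / (p * q * (p + q)) - t\<^sup>2 / (p * q * (p + q))"
      using q2 by (simp add: diff_divide_distrib add_divide_distrib)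
    finally have "1 / q - 1 / p + s / p ^ 3
        = s * (1 / p ^ 3 - 2 / (p * q * (p + q))) - t\<^sup>2 / (p * q * (p + q))"
      by (simp add: algebra_simps)
    moreover have "1 / p ^ 3 - 2 / (p * q * (p + q)) = (q - p) * (q + 2 * p) / (p ^ 3 * q * (p + q))"
      using pos add_pos_pos[OF pos(1,2)]
      by (simp add: divide_simps) (simp add: algebra_simps power2_eq_square power3_eq_cube)
    ultimately show ?thesis by simp
  qed
  moreover have "\<bar>s * ((q - p) * (q + 2 * p)) / (p ^ 3 * q * (p + q))\<bar> \<le> 2 * t\<^sup>2 / (p\<^sup>2 * q)"
  proof -
    have "\<bar>s * ((q - p) * (q + 2 * p)) / (p ^ 3 * q * (p + q))\<bar>
        = \<bar>s\<bar> * (\<bar>q - p\<bar> * (q + 2 * p)) / (p ^ 3 * q * (p + q))"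
      using pos by (simp add: abs_mult)
    also have "\<dots> \<le> (p * t) * (t * (2 * (p + q))) / (p ^ 3 * q * (p + q))"
      using pos s qp by (intro divide_right_mono mult_mono) auto
    also have "\<dots> = 2 * t\<^sup>2 / (p\<^sup>2 * q)"
      using pos add_pos_pos[OF pos(1,2)]
      by (simp add: divide_simps) (simp add: algebra_simps power2_eq_square power3_eq_cube)
    finally show ?thesis .
  qed
  moreover have "\<bar>t\<^sup>2 / (p * q * (p + q))\<bar> \<le> t\<^sup>2 / (p\<^sup>2 * q)"
  proof -
    have "p\<^sup>2 * q \<le> p * q * (p + q)"
      using pos by (simp add: power2_eq_square algebra_simps)
    then show ?thesis
      using pos by (auto simp: abs_mult intro!: divide_left_mono)
  qed
  ultimately have "\<bar>1 / q - 1 / p + s / p ^ 3\<bar> \<le> 2 * t\<^sup>2 / (p\<^sup>2 * q) + t\<^sup>2 / (p\<^sup>2 * q)"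
    by linarith
  also have "\<dots> = 3 * t\<^sup>2 / (p\<^sup>2 * q)"
    by (simp flip: add_divide_distrib)
  finally show ?thesis
    unfolding p_def q_def s_def t_def .
qed

section \<open>Newtonian potentials of bounded densities\<close>

locale bounded_density =
  fixes D :: "(real^3) set" and u :: field3 and M :: real
  assumes bounded_domain_of_density: "bounded D"
    and sets_domain: "D \<in> sets lebesgue"
    and measurable_density: "u \<in> borel_measurable (lebesgue_on D)"
    and density_le: "\<And>y. y \<in> D \<Longrightarrow> norm (u y) \<le> M"
    and bound_nonneg: "0 \<le> M"
begin

abbreviation vol :: real where "vol \<equiv> measure lebesgue D"

lemma lmeasurable_domain: "D \<in> lmeasurable"
  using bounded_domain_of_density sets_domain by (rule bounded_set_imp_lmeasurable)

definition potential :: "field3" where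
  "potential x = (LINT y|lebesgue_on D. u y / of_real (norm (x - y)))"

lemma borel_imp_lebesgue_on:
  assumes "k \<in> borel_measurable borel"
  shows "k \<in> borel_measurable (lebesgue_on D)"
  using assms by (intro measurable_restrict_space1 measurable_completion) simp

lemma density_times_bounded_kernel:
  fixes k :: "real^3 \<Rightarrow> real"
  assumes "k \<in> borel_measurable borel" "\<And>y. y \<in> D \<Longrightarrow> \<bar>k y\<bar> \<le> B" "0 \<le> B"
  shows "integrable (lebesgue_on D) (\<lambda>y. u y * of_real (k y))"
    and "norm (LINT y|lebesgue_on D. u y * of_real (k y)) \<le> M * B * vol"
proof -
  have meas: "(\<lambda>y. u y * of_real (k y)) \<in> borel_measurable (lebesgue_on D)"
    using measurable_density borel_imp_lebesgue_on[OF assms(1)] by simp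
  have bnd: "norm (u y * of_real (k y)) \<le> M * B" if "y \<in> D" for y
    unfolding norm_mult norm_of_real
    using density_le[OF that] assms(2)[OF that] bound_nonneg by (intro mult_mono) auto
  have const: "integrable (lebesgue_on D) (\<lambda>y. M * B)"
    using lmeasurable_domain by (intro finite_measure.integrable_const finite_measure_lebesgue_on)
  show int: "integrable (lebesgue_on D) (\<lambda>y. u y * of_real (k y))"
    using const meas
  proof (rule Bochner_Integration.integrable_bound)
    show "AE y in lebesgue_on D. norm (u y * of_real (k y)) \<le> norm (M * B)"
      using bnd by (intro AE_I2) (force simp: space_restrict_space)
  qed
  have "norm (LINT y|lebesgue_on D. u y * of_real (k y))
      \<le> (LINT y|lebesgue_on D. norm (u y * of_real (k y)))"
    by (rule integral_norm_bound)
  also have "\<dots> \<le> (LINT y|lebesgue_on D. M * B)"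
    using int const bnd by (intro integral_mono) (auto simp: space_restrict_space)
  also have "\<dots> = M * B * vol"
    using sets_domain by (simp add: measure_restrict_space space_restrict_space)
  finally show "norm (LINT y|lebesgue_on D. u y * of_real (k y)) \<le> M * B * vol" .
qed

lemma integrable_potential: "integrable (lebesgue_on D) (\<lambda>y. u y / of_real (norm (x - y)))"
proof -
  obtain R where R: "0 < R" "D \<subseteq> ball x R"
    using bounded_subset_ballD[OF bounded_domain_of_density, of x] by auto
  have "integrable (lebesgue_on D) (\<lambda>y. M * (indicat_real (ball x R) y / norm (x - y)))"
    using integral_inverse_distance_near(1)[OF R(1) sets_domain] by (rule integrable_mult_right)
  then show ?thesis
  proof (rule Bochner_Integration.integrable_bound)
    have "(\<lambda>y. norm (x - y)) \<in> borel_measurable (lebesgue_on D)"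
      by (intro borel_imp_lebesgue_on) measurable
    then show "(\<lambda>y. u y / of_real (norm (x - y))) \<in> borel_measurable (lebesgue_on D)"
      using measurable_density by measurable
    show "AE y in lebesgue_on D. norm (u y / of_real (norm (x - y)))
        \<le> norm (M * (indicat_real (ball x R) y / norm (x - y)))"
    proof (rule AE_I2)
      fix y assume "y \<in> space (lebesgue_on D)"
      then have "y \<in> D" by (simp add: space_restrict_space)
      then show "norm (u y / of_real (norm (x - y)))
          \<le> norm (M * (indicat_real (ball x R) y / norm (x - y)))"
        using density_le[of y] R(2) bound_nonneg
        by (auto simp: norm_divide subset_iff intro!: divide_right_mono)
    qed
  qed
qed

text \<open>
  Capping the kernel at height \<open>1 / r\<close> makes it Lipschitz in \<open>x\<close>, and changes it only on the ball of
  radius \<open>r\<close>. Hence the truncated potentials are continuous and converge uniformly.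
\<close>

definition truncated_potential :: "real \<Rightarrow> field3" where
  "truncated_potential r x = (LINT y|lebesgue_on D. u y * of_real (1 / max r (norm (x - y))))"

lemma integrable_truncated_potential:
  assumes "0 < r"
  shows "integrable (lebesgue_on D) (\<lambda>y. u y * of_real (1 / max r (norm (x - y))))"
proof (rule density_times_bounded_kernel(1))
  show "\<bar>1 / max r (norm (x - y))\<bar> \<le> 1 / r" for y
    using assms by (auto simp: max_def divide_simps)
qed (use assms in auto)

lemma continuous_truncated_potential:
  assumes "0 < r"
  shows "continuous_on UNIV (truncated_potential r)"
proof (rule lipschitz_on_continuous_on, rule lipschitz_onI)
  fix x z :: "real^3"
  define k where "k y = 1 / max r (norm (x - y)) - 1 / max r (norm (z - y))" for y
  have "\<bar>k y\<bar> \<le> dist x z / r\<^sup>2" for y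
  proof -
    define a where "a = max r (norm (x - y))"
    define b where "b = max r (norm (z - y))"
    have ab: "r \<le> a" "r \<le> b" by (auto simp: a_def b_def)
    have "\<bar>norm (z - y) - norm (x - y)\<bar> \<le> dist x z"
      using norm_triangle_ineq3[of "z - y" "x - y"] by (simp add: dist_norm norm_minus_commute)
    then have "\<bar>b - a\<bar> \<le> dist x z"
      by (auto simp: a_def b_def max_def)
    moreover have "r\<^sup>2 \<le> a * b"
      using ab assms unfolding power2_eq_square by (intro mult_mono) auto
    moreover have "k y = (b - a) / (a * b)"
      using ab assms by (simp add: k_def a_def[symmetric] b_def[symmetric] field_simps)
    ultimately show ?thesis
      using assms ab by (auto simp: abs_mult intro!: frac_le)
  qed
  then have "norm (LINT y|lebesgue_on D. u y * of_real (k y)) \<le> M * (dist x z / r\<^sup>2) * vol"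
    using assms by (intro density_times_bounded_kernel(2)) (auto simp: k_def[abs_def])
  moreover have "truncated_potential r x - truncated_potential r z
      = (LINT y|lebesgue_on D. u y * of_real (k y))"
    unfolding truncated_potential_def k_def
    by (subst Bochner_Integration.integral_diff[symmetric])
      (simp_all add: integrable_truncated_potential assms algebra_simps
         del: of_real_divide)
  ultimately show "dist (truncated_potential r x) (truncated_potential r z)
      \<le> (M * vol / r\<^sup>2) * dist x z"
    by (simp add: dist_norm field_simps)
qed (use bound_nonneg in auto)

lemma truncation_error_le:
  assumes "0 < r"
  shows "norm (potential x - truncated_potential r x) \<le> M * (8 / 3 * unit_ball_vol 3 * r\<^sup>2)"
proof -
  let ?k = "\<lambda>y. indicat_real (ball x r) y / norm (x - y)"
  let ?g = "\<lambda>y. u y / of_real (norm (x - y)) - u y * of_real (1 / max r (norm (x - y)))"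
  note near = integral_inverse_distance_near[OF assms sets_domain, of x]
  have int: "integrable (lebesgue_on D) ?g"
    by (intro Bochner_Integration.integrable_diff integrable_potential
        integrable_truncated_potential assms)
  \<comment> \<open>At \<open>y = x\<close> the kernel has the value \<open>1 / 0 = 0\<close>, but the truncated kernel \<open>1 / r\<close>: the pointwise
    bound fails there.\<close>
  have "AE y in lborel. y \<noteq> x"
    by (rule AE_lborel_singleton)
  then have "AE y in lebesgue. y \<noteq> x"
    by (simp add: AE_completion)
  then have "AE y in lebesgue_on D. y \<noteq> x"
    using sets_domain by (simp add: AE_restrict_space_iff) (erule eventually_mono, simp)
  moreover have "AE y in lebesgue_on D. y \<in> D"
    by (rule AE_I2) (simp add: space_restrict_space)
  ultimately have bnd: "AE y in lebesgue_on D. norm (?g y) \<le> M * ?k y"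
  proof eventually_elim
    case (elim y)
    define t where "t = norm (x - y)"
    have "0 < t" using elim by (simp add: t_def)
    have "?g y = u y * of_real (1 / t - 1 / max r t)"
      by (simp add: t_def algebra_simps divide_inverse)
    then have "norm (?g y) = norm (u y) * \<bar>1 / t - 1 / max r t\<bar>"
      by (simp only: norm_mult norm_of_real)
    also have "\<dots> \<le> M * ?k y"
    proof (rule mult_mono)
      show "\<bar>1 / t - 1 / max r t\<bar> \<le> ?k y"
      proof (cases "t < r")
        case True
        then have "1 / r \<le> 1 / t" using \<open>0 < t\<close> by (simp add: field_simps)
        then show ?thesis
          using True \<open>0 < t\<close> assms by (auto simp: max_def t_def dist_norm)
      next
        case False
        then show ?thesis using \<open>0 < t\<close> by (simp add: max_def t_def)
      qed
    qed (use density_le elim bound_nonneg in auto)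
    finally show ?case .
  qed
  have "norm (potential x - truncated_potential r x) = norm (LINT y|lebesgue_on D. ?g y)"
    unfolding potential_def truncated_potential_def
    by (simp only: Bochner_Integration.integral_diff integrable_potential
        integrable_truncated_potential assms)
  also have "\<dots> \<le> (LINT y|lebesgue_on D. norm (?g y))"
    by (rule integral_norm_bound)
  also have "\<dots> \<le> (LINT y|lebesgue_on D. M * ?k y)"
    using int near(1) bnd
    by (intro integral_mono_AE Bochner_Integration.integrable_norm integrable_mult_right)
  also have "\<dots> = M * (LINT y|lebesgue_on D. ?k y)"
    by (rule integral_mult_right_zero)
  also have "\<dots> \<le> M * (8 / 3 * unit_ball_vol 3 * r\<^sup>2)"
    using near(2) bound_nonneg by (rule mult_left_mono)
  finally show ?thesis .
qed

theorem continuous_potential: "continuous_on UNIV potential"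
proof (rule uniform_limit_theorem)
  show "\<forall>\<^sub>F r in at_right 0. continuous_on UNIV (truncated_potential r)"
    using eventually_at_right_less[of "0::real"] by eventually_elim (rule continuous_truncated_potential)
  show "uniform_limit UNIV truncated_potential potential (at_right 0)"
  proof (rule uniform_limitI)
    fix e :: real assume "0 < e"
    have "((\<lambda>r. M * (8 / 3 * unit_ball_vol 3 * r\<^sup>2)) \<longlongrightarrow> M * (8 / 3 * unit_ball_vol 3 * 0\<^sup>2)) (at_right 0)"
      by (intro tendsto_intros)
    then have "\<forall>\<^sub>F r in at_right 0. M * (8 / 3 * unit_ball_vol 3 * r\<^sup>2) < e"
      using \<open>0 < e\<close> by (intro order_tendstoD(2)) auto
    then show "\<forall>\<^sub>F r in at_right 0. \<forall>x\<in>UNIV. dist (truncated_potential r x) (potential x) < e"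
      using eventually_at_right_less[of "0::real"]
    proof eventually_elim
      case (elim r)
      then show ?case
        using le_less_trans[OF truncation_error_le[OF elim(2)] elim(1)]
        by (simp add: dist_norm norm_minus_commute)
    qed
  qed
qed simp

text \<open>
  The kernel expands to first order at \<open>x\<close> with a remainder that is quadratic uniformly over the
  source points, as these keep a positive distance from \<open>x\<close>; integrating the expansion against the
  density gives the derivative.
\<close>

theorem differentiable_potential:
  assumes "x \<notin> closure D"
  shows "potential differentiable (at x)"
proof -
  obtain \<delta> where \<delta>: "0 < \<delta>" and far: "\<And>y. y \<in> D \<Longrightarrow> \<delta> \<le> norm (x - y)"
    using assms by (auto simp: closure_approachable dist_norm norm_minus_commute not_less)
  define k where "k h y = - ((x - y) \<bullet> h) / norm (x - y) ^ 3" for h y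
  define L where "L h = (LINT y|lebesgue_on D. u y * of_real (k h y))" for h
  have k_meas: "k h \<in> borel_measurable borel" for h
    unfolding k_def by measurable
  have k_le: "\<bar>k h y\<bar> \<le> norm h / \<delta>\<^sup>2" if "y \<in> D" for h y
  proof -
    define p where "p = norm (x - y)"
    have p: "\<delta> \<le> p" using far[OF that] by (simp add: p_def)
    have "\<bar>k h y\<bar> \<le> (p * norm h) / p ^ 3"
      using Cauchy_Schwarz_ineq2[of "x - y" h] by (auto simp: k_def p_def intro!: divide_right_mono)
    also have "\<dots> = norm h / p\<^sup>2"
      using p \<delta> by (simp add: power2_eq_square power3_eq_cube)
    also have "\<dots> \<le> norm h / \<delta>\<^sup>2"
      using p \<delta> by (intro divide_left_mono) auto
    finally show ?thesis .
  qed
  have k_int: "integrable (lebesgue_on D) (\<lambda>y. u y * of_real (k h y))" for h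
    by (rule density_times_bounded_kernel(1)[OF k_meas k_le]) simp_all
  have "linear L"
  proof (rule linearI)
    fix g h
    have "(\<lambda>y. u y * of_real (k (g + h) y))
        = (\<lambda>y. u y * of_real (k g y) + u y * of_real (k h y))"
      by (simp add: k_def fun_eq_iff inner_add_right add_divide_distrib diff_divide_distrib ring_distribs)
    then show "L (g + h) = L g + L h"
      unfolding L_def using k_int by simp
  next
    fix c :: real and h
    have "(\<lambda>y. u y * of_real (k (c *\<^sub>R h) y)) = (\<lambda>y. of_real c * (u y * of_real (k h y)))"
      by (simp add: k_def fun_eq_iff algebra_simps)
    then show "L (c *\<^sub>R h) = c *\<^sub>R L h"
      unfolding L_def by (simp add: scaleR_conv_of_real)
  qed
  then have "bounded_linear L"
    by (rule linear_conv_bounded_linear[THEN iffD1])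
  have "(potential has_derivative L) (at x within UNIV)"
  proof (rule has_derivativeI_sandwich)
    show "0 < \<delta> / 2" using \<delta> by simp
    show "bounded_linear L" by fact
    show "norm ((potential z - potential x) - L (z - x)) / norm (z - x)
        \<le> 6 * M * vol / \<delta> ^ 3 * norm (z - x)" if "z \<noteq> x" "dist z x < \<delta> / 2" for z
    proof -
      define h where "h = z - x"
      define e where "e y = 1 / norm ((x - y) + h) - 1 / norm (x - y) - k h y" for y
      have h: "h \<noteq> 0" "norm h < \<delta> / 2" using that by (auto simp: h_def dist_norm)
      have "\<bar>e y\<bar> \<le> 6 * (norm h)\<^sup>2 / \<delta> ^ 3" if "y \<in> D" for y
      proof -
        define a where "a = x - y"
        have a: "\<delta> \<le> norm a" using far[OF that] by (simp add: a_def)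
        \<comment> \<open>The increment is at most half the distance to the sources, so \<open>a + h\<close> stays off \<open>0\<close> as well.\<close>
        have ah: "\<delta> / 2 \<le> norm (a + h)"
          using norm_diff_ineq[of a h] a h by linarith
        have "\<bar>e y\<bar> = \<bar>1 / norm (a + h) - 1 / norm a + (a \<bullet> h) / norm a ^ 3\<bar>"
          by (simp add: e_def k_def a_def)
        also have "\<dots> \<le> 3 * (norm h)\<^sup>2 / ((norm a)\<^sup>2 * norm (a + h))"
          using a ah \<delta> by (intro inverse_norm_taylor) auto
        also have "\<dots> \<le> 3 * (norm h)\<^sup>2 / (\<delta>\<^sup>2 * (\<delta> / 2))"
          using a ah \<delta> by (intro divide_left_mono mult_mono mult_pos_pos) auto
        also have "\<dots> = 6 * (norm h)\<^sup>2 / \<delta> ^ 3"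
          by (simp add: power2_eq_square power3_eq_cube)
        finally show ?thesis .
      qed
      then have "norm (LINT y|lebesgue_on D. u y * of_real (e y))
          \<le> M * (6 * (norm h)\<^sup>2 / \<delta> ^ 3) * vol"
        using k_meas[of h] \<delta> unfolding e_def
        by (intro density_times_bounded_kernel(2)) (auto intro!: borel_measurable_diff)
      moreover have "(LINT y|lebesgue_on D. u y * of_real (e y))
          = (potential z - potential x) - L h"
      proof -
        have "(\<lambda>y. u y * of_real (e y)) = (\<lambda>y. u y / of_real (norm (z - y))
            - u y / of_real (norm (x - y)) - u y * of_real (k h y))"
          by (simp add: e_def h_def fun_eq_iff algebra_simps divide_inverse)
        then show ?thesis
          unfolding potential_def L_def
          by (simp only: Bochner_Integration.integral_diff Bochner_Integration.integrable_diff
              integrable_potential k_int)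
      qed
      ultimately have "norm ((potential z - potential x) - L h) \<le> M * (6 * (norm h)\<^sup>2 / \<delta> ^ 3) * vol"
        by simp
      then show ?thesis
        using h by (simp add: h_def[symmetric] field_simps power2_eq_square)
    qed
    have "((\<lambda>z. 6 * M * vol / \<delta> ^ 3 * norm (z - x)) \<longlongrightarrow> 6 * M * vol / \<delta> ^ 3 * norm (x - x)) (at x)"
      by (intro tendsto_intros)
    then show "((\<lambda>z. 6 * M * vol / \<delta> ^ 3 * norm (z - x)) \<longlongrightarrow> 0) (at x)"
      by simp
  qed
  then show ?thesis
    unfolding differentiable_def by blast
qed

lemma newton_eq_potential: "newton D u x = - (1 / (4 * of_real pi)) * potential x"
  by (simp add: newton_def potential_def)

corollary continuous_newton: "continuous_on UNIV (newton D u)"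
  unfolding newton_eq_potential[abs_def] by (intro continuous_intros continuous_potential)

corollary differentiable_newton:
  assumes "x \<notin> closure D"
  shows "newton D u differentiable (at x)"
  unfolding newton_eq_potential[abs_def]
  by (intro differentiable_mult differentiable_const differentiable_potential assms)

end

section \<open>The gradient along a segment\<close>

text \<open>
  The Cauchy-Schwarz inequality, applied to the moduli of the complex partial derivatives.
\<close>

lemma norm_frechet_derivative_le_cgrad:
  assumes "f differentiable (at y)"
  shows "norm (frechet_derivative f (at y) v) \<le> norm (cgrad f y) * norm v"
proof -
  let ?f' = "frechet_derivative f (at y)"
  have "linear ?f'"
    by (rule linear_frechet_derivative[OF assms])
  then have "?f' (\<Sum>j\<in>UNIV. v $ j *\<^sub>R axis j 1) = (\<Sum>j\<in>UNIV. v $ j *\<^sub>R ?f' (axis j 1))"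
    by (simp only: linear_sum linear_scale)
  moreover have "(\<Sum>j\<in>UNIV. v $ j *\<^sub>R axis j 1) = v"
    by (simp add: basis_expansion flip: scalar_mult_eq_scaleR)
  ultimately have "?f' v = (\<Sum>j\<in>UNIV. v $ j *\<^sub>R ?f' (axis j 1))"
    by simp
  also have "norm \<dots> \<le> (\<Sum>j\<in>UNIV. \<bar>v $ j\<bar> * norm (?f' (axis j 1)))"
    by (rule order_trans[OF norm_sum]) simp
  also have "\<dots> \<le> L2_set (\<lambda>j. v $ j) UNIV * L2_set (\<lambda>j. norm (?f' (axis j 1))) UNIV"
    using L2_set_mult_ineq[of "\<lambda>j. v $ j" "\<lambda>j. norm (?f' (axis j 1))" UNIV] by simp
  also have "\<dots> = norm v * norm (cgrad f y)"
    by (simp add: norm_vec_def cgrad_def L2_set_def)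
  finally show ?thesis by (simp add: mult.commute)
qed

text \<open>
  The mean value inequality on the open segment; the end points need continuity only, which is
  essential when they lie on the boundary of the support of the density.
\<close>

lemma segment_gradient_ge:
  fixes f :: field3
  assumes cont: "continuous_on (closed_segment a b) f" and "a \<noteq> b"
    and diff: "\<And>y. y \<in> open_segment a b \<Longrightarrow> f differentiable (at y)"
  obtains y where "y \<in> open_segment a b" "norm (f b - f a) \<le> norm (cgrad f y) * norm (b - a)"
proof -
  define g where "g t = f (a + t *\<^sub>R (b - a))" for t
  have seg: "a + t *\<^sub>R (b - a) = (1 - t) *\<^sub>R a + t *\<^sub>R b" for t
    by (simp add: algebra_simps)
  have "continuous_on {0..1} g"
    unfolding g_def
    by (rule continuous_on_compose2[OF cont])
      (auto intro!: continuous_intros simp: closed_segment_def seg)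
  moreover have "(g has_derivative
      (\<lambda>s. frechet_derivative f (at (a + t *\<^sub>R (b - a))) (s *\<^sub>R (b - a)))) (at t)"
    if "0 < t" "t < 1" for t
  proof -
    have "a + t *\<^sub>R (b - a) \<in> open_segment a b"
      using that \<open>a \<noteq> b\<close> by (auto simp: in_segment seg)
    then have "(f has_derivative frechet_derivative f (at (a + t *\<^sub>R (b - a)))) (at (a + t *\<^sub>R (b - a)))"
      using diff by (simp add: frechet_derivative_works[symmetric])
    moreover have "((\<lambda>t. a + t *\<^sub>R (b - a)) has_derivative (\<lambda>s. s *\<^sub>R (b - a))) (at t)"
      by (auto intro!: derivative_eq_intros)
    ultimately show ?thesis
      unfolding g_def by (rule has_derivative_compose[rotated])
  qed
  ultimately obtain t where t: "t \<in> {0<..<1}"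
    "norm (g 1 - g 0) \<le> norm (frechet_derivative f (at (a + t *\<^sub>R (b - a))) ((1 - 0) *\<^sub>R (b - a)))"
    using mvt_general[of 0 1 g "\<lambda>t s. frechet_derivative f (at (a + t *\<^sub>R (b - a))) (s *\<^sub>R (b - a))"]
    by auto
  define y where "y = a + t *\<^sub>R (b - a)"
  have y: "y \<in> open_segment a b"
    using t(1) \<open>a \<noteq> b\<close> by (auto simp: in_segment y_def seg)
  have "norm (f b - f a) \<le> norm (frechet_derivative f (at y) (b - a))"
    using t(2) by (simp add: g_def y_def)
  also have "\<dots> \<le> norm (cgrad f y) * norm (b - a)"
    by (rule norm_frechet_derivative_le_cgrad[OF diff[OF y]])
  finally show ?thesis using that y by blast
qed

section \<open>The gap between the two domains\<close>

text \<open>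
  An interior point is closer to either end point than the two end points are to each other, so if
  it belonged to one of the closures, the distance of the sets would be smaller than it is.
\<close>

lemma shortest_segment_avoids_closures:
  fixes x1 x2 :: "'a::euclidean_space"
  assumes "x1 \<in> closure S" "x2 \<in> closure T" "norm (x2 - x1) = setdist S T"
    and y: "y \<in> open_segment x1 x2"
  shows "y \<notin> closure (S \<union> T)"
proof
  have "dist x1 y < dist x1 x2" "dist y x2 < dist x1 x2"
    using dist_in_open_segment[OF y] by (simp_all add: dist_commute)
  moreover have "setdist S T \<le> dist y x2" if "y \<in> closure S"
    using setdist_le_dist[OF that assms(2)] by simp
  moreover have "setdist S T \<le> dist x1 y" if "y \<in> closure T"
    using setdist_le_dist[OF assms(1) that] by simp
  moreover assume "y \<in> closure (S \<union> T)"
  ultimately show False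
    using assms(3) by (auto simp: dist_norm norm_minus_commute)
qed

text \<open>
  The supremum of an unbounded set of reals is unspecified; compactness of the closure makes
  \<^const>\<open>c0norm\<close> a genuine bound.
\<close>

lemma norm_le_c0norm:
  assumes "bounded D" "continuous_on (closure D) u" "x \<in> closure D"
  shows "norm (u x) \<le> c0norm D u"
proof -
  have "compact ((\<lambda>x. norm (u x)) ` closure D)"
    using assms by (intro compact_continuous_image continuous_intros) (auto simp: compact_closure)
  then show ?thesis
    unfolding c0norm_def using assms(3)
    by (intro cSUP_upper) (auto intro: bounded_imp_bdd_above compact_imp_bounded)
qed

text \<open>
  The maximum with \<open>0\<close> covers the empty set, for which the supremum norm is unspecified.
\<close>

lemma bounded_density_eigenfunction:
  assumes "eigenpair D T z u" "bounded D" "open D"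
  shows "bounded_density D u (max 0 (c0norm D u))"
proof
  show "D \<in> sets lebesgue"
    using assms(3) by (simp add: borel_open)
  show "u \<in> borel_measurable (lebesgue_on D)"
    using assms(1) by (simp add: eigenpair_def L2_def)
  show "norm (u y) \<le> max 0 (c0norm D u)" if "y \<in> D" for y
  proof -
    have "norm (u y) \<le> c0norm D u"
      using assms that closure_subset by (intro norm_le_c0norm) (auto simp: eigenpair_def)
    then show ?thesis by simp
  qed
qed (use assms in auto)

text \<open>
  The eigenpair property makes \<open>\<Phi>\<kappa>\<close> a bounded measurable density; all regularity in the gap then
  comes from its representation as a potential.
\<close>

lemma gap_gradient_ge:
  assumes dom: "bounded_domain D1" "bounded_domain D2"
    and dist: "\<kappa> = setdist D1 D2" "0 < \<kappa>"
    and \<Phi>: "continuous_on (closure (D1 \<union> D2)) \<Phi>"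
    and coupled: "eigenpair (D1 \<union> D2) T z \<Phi>\<kappa>"
    and represent: "\<And>x. \<Phi>\<kappa> x = inverse \<rho>\<kappa> * newton (D1 \<union> D2) \<Phi>\<kappa> x"
    and pts: "x1 \<in> frontier D1" "x2 \<in> frontier D2" "norm (x2 - x1) = \<kappa>"
    and jump: "cs \<le> norm (\<Phi> x2 - \<Phi> x1)"
    and close: "c0norm (D1 \<union> D2) (\<lambda>x. \<Phi>\<kappa> x - \<Phi> x) \<le> cs / 4"
  shows "\<exists>y\<in>closed_segment x1 x2.
           \<Phi>\<kappa> differentiable (at y) \<and> cs / (2 * \<kappa>) \<le> norm (cgrad \<Phi>\<kappa> y)"
proof -
  define D where "D = D1 \<union> D2"
  have D: "bounded D" "open D"
    using dom by (auto simp: D_def bounded_domain_def)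
  interpret bounded_density D \<Phi>\<kappa> "max 0 (c0norm D \<Phi>\<kappa>)"
    using bounded_density_eigenfunction[of D T z \<Phi>\<kappa>] coupled D by (simp add: D_def)
  have \<Phi>\<kappa>_eq: "\<Phi>\<kappa> = (\<lambda>x. inverse \<rho>\<kappa> * newton D \<Phi>\<kappa> x)"
    using represent unfolding D_def by blast
  have x: "x1 \<in> closure D1" "x2 \<in> closure D2"
    using pts by (auto simp: frontier_def)
  then have xD: "x1 \<in> closure D" "x2 \<in> closure D"
    by (auto simp: D_def)
  have "continuous_on UNIV (\<lambda>x. inverse \<rho>\<kappa> * newton D \<Phi>\<kappa> x)"
    by (intro continuous_intros continuous_newton)
  then have cont: "continuous_on UNIV \<Phi>\<kappa>"
    by (subst \<Phi>\<kappa>_eq)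
  have diff: "\<Phi>\<kappa> differentiable (at y)" if "y \<in> open_segment x1 x2" for y
  proof -
    have "y \<notin> closure D"
      unfolding D_def using x pts(3) dist(1) that by (intro shortest_segment_avoids_closures) auto
    then have "(\<lambda>x. inverse \<rho>\<kappa> * newton D \<Phi>\<kappa> x) differentiable (at y)"
      by (intro differentiable_mult differentiable_const differentiable_newton)
    then show ?thesis by (subst \<Phi>\<kappa>_eq)
  qed
  have "x1 \<noteq> x2" using pts(3) dist(2) by auto
  then obtain y where y: "y \<in> open_segment x1 x2"
    "norm (\<Phi>\<kappa> x2 - \<Phi>\<kappa> x1) \<le> norm (cgrad \<Phi>\<kappa> y) * norm (x2 - x1)"
    using segment_gradient_ge[OF continuous_on_subset[OF cont subset_UNIV] _ diff] by blast
  have near: "norm (\<Phi>\<kappa> w - \<Phi> w) \<le> cs / 4" if "w \<in> closure D" for w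
  proof -
    have "norm (\<Phi>\<kappa> w - \<Phi> w) \<le> c0norm D (\<lambda>x. \<Phi>\<kappa> x - \<Phi> x)"
      using continuous_on_diff[OF continuous_on_subset[OF cont subset_UNIV] \<Phi>[folded D_def]]
      by (rule norm_le_c0norm[OF D(1) _ that])
    then show ?thesis using close by (simp add: D_def)
  qed
  \<comment> \<open>Each end point loses at most \<open>cs / 4\<close> of the jump.\<close>
  have "\<Phi> x2 - \<Phi> x1 = (\<Phi>\<kappa> x2 - \<Phi>\<kappa> x1) - (\<Phi>\<kappa> x2 - \<Phi> x2) + (\<Phi>\<kappa> x1 - \<Phi> x1)"
    by simp
  then have "norm (\<Phi> x2 - \<Phi> x1)
      \<le> norm (\<Phi>\<kappa> x2 - \<Phi>\<kappa> x1) + norm (\<Phi>\<kappa> x2 - \<Phi> x2) + norm (\<Phi>\<kappa> x1 - \<Phi> x1)"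
    using norm_triangle_ineq[of "(\<Phi>\<kappa> x2 - \<Phi>\<kappa> x1) - (\<Phi>\<kappa> x2 - \<Phi> x2)" "\<Phi>\<kappa> x1 - \<Phi> x1"]
      norm_triangle_ineq4[of "\<Phi>\<kappa> x2 - \<Phi>\<kappa> x1" "\<Phi>\<kappa> x2 - \<Phi> x2"] by simp
  then have "cs / 2 \<le> norm (cgrad \<Phi>\<kappa> y) * \<kappa>"
    using near[OF xD(1)] near[OF xD(2)] jump y(2) pts(3) by simp
  then have "cs / (2 * \<kappa>) \<le> norm (cgrad \<Phi>\<kappa> y)"
    using dist(2) by (simp add: field_simps)
  with y(1) diff show ?thesis
    using segment_open_subset_closed by blast
qed

theorem theorem5p1:
  shows "\<exists>c::real. c > 0 \<and>
    (\<forall>(D1 :: (real^3) set) (D2 :: (real^3) set) (\<kappa>::real) (\<rho>::complex) (\<Phi>::field3)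
       (\<rho>\<kappa>::complex) (\<Phi>\<kappa>::field3) (x1::real^3) (x2::real^3) (C::real) (cs::real).
       bounded_domain D1 \<and> bounded_domain D2 \<and>
       \<kappa> = setdist D1 D2 \<and> \<kappa> > 0 \<and>
       simple_eigenvalue (D1 \<union> D2) (newton_diag D1 D2) \<rho> \<and>
       \<rho> isolated_in l2_spectrum (D1 \<union> D2) (newton_diag D1 D2) \<and>
       eigenpair (D1 \<union> D2) (newton_diag D1 D2) \<rho> \<Phi> \<and>
       l2norm (D1 \<union> D2) \<Phi> = 1 \<and>
       coupled_eigenmode D1 D2 \<rho> \<Phi> \<rho>\<kappa> \<Phi>\<kappa> \<and>
       (\<forall>x. \<Phi>\<kappa> x = inverse \<rho>\<kappa> * newton (D1 \<union> D2) \<Phi>\<kappa> x) \<and>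
       x1 \<in> frontier D1 \<and> x2 \<in> frontier D2 \<and> norm (x2 - x1) = \<kappa> \<and>
       eps2 D1 D2 \<le> c * spec_gap D1 D2 \<rho> \<and>
       C > 0 \<and>
       c0norm (D1 \<union> D2) (\<lambda>x. \<Phi>\<kappa> x - \<Phi> x) \<le>
         C * (C0_diag D1 D2 / norm \<rho> * (eps2 D1 D2 / spec_gap D1 D2 \<rho>)
              + eps_inf D1 D2 / norm \<rho>
              + eps_inf D1 D2 / norm \<rho> * (eps2 D1 D2 / spec_gap D1 D2 \<rho>)
              + C0_diag D1 D2 / (norm \<rho>)\<^sup>2 * ((eps2 D1 D2)\<^sup>2 / spec_gap D1 D2 \<rho>)) \<and>
       cs > 0 \<and> norm (\<Phi> x2 - \<Phi> x1) \<ge> cs \<and>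
       c0norm (D1 \<union> D2) (\<lambda>x. \<Phi>\<kappa> x - \<Phi> x) \<le> cs / 4
       \<longrightarrow> (\<exists>y\<in>closed_segment x1 x2.
              \<Phi>\<kappa> differentiable (at y) \<and> norm (cgrad \<Phi>\<kappa> y) \<ge> cs / (2 * \<kappa>)))"
proof (intro exI[of _ 1] conjI allI impI, goal_cases)
  case (2 D1 D2 \<kappa> \<rho> \<Phi> \<rho>\<kappa> \<Phi>\<kappa> x1 x2 C cs)
  then have "continuous_on (closure (D1 \<union> D2)) \<Phi>" "eigenpair (D1 \<union> D2) (newton (D1 \<union> D2)) \<rho>\<kappa> \<Phi>\<kappa>"
    unfolding eigenpair_def[of _ _ \<rho>] coupled_eigenmode_def Let_def by blast+
  with 2 show ?case
    by (intro gap_gradient_ge[of D1 D2 \<kappa> \<Phi> "newton (D1 \<union> D2)" \<rho>\<kappa> \<Phi>\<kappa> \<rho>\<kappa> x1 x2 cs]) blast+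
qed simp

end
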